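(* For even $n$, let $\Pi_n$ be a permutation chosen uniformly at random from all $n!$ permutations of $[n]=\{1,\dots,n\}$. Then, asymptotically almost surely, $r_{tt}^{(2)}(\Pi_n)=n/2$; that is, $\mathbb{P}\big(r_{tt}^{(2)}(\Pi_n)=n/2\big)\to 1$ as $n\to\infty$ through even integers.
   Context: A permutation is any finite sequence of distinct integers. Two permutations $(x_1,\dots,x_k)$ and $(y_1,\dots,y_k)$ of the same length are similar if $x_i<x_j$ if and only if $y_i<y_j$ for all $1\le i<j\le k$. A collection of $r$ pairwise disjoint (occupying pairwise disjoint sets of positions), pairwise similar subsequences of a permutation $\pi$, each of length $k$, forms tight $r$-twins of length $k$ in $\pi$ if the union of the positions they occupy is a segment of consecutive positions of $\pi$ (of length $rk$). Given $k$ and a permutation $\pi$, $r_{tt}^{(k)}(\pi)$ is the largest $r$ (with $r=1$ allowed) such that $\pi$ contains tight $r$-twins of length $k$. *)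

theory Defs
  imports "HOL-Probability.Probability" "HOL-Combinatorics.Multiset_Permutations"
begin

text \<open>
  A permutation is a finite sequence of distinct integers, i.e. an \<^typ>\<open>int list\<close> satisfying
  \<^const>\<open>distinct\<close>. Positions are counted from 0.
\<close>

definition similar :: "int list \<Rightarrow> int list \<Rightarrow> bool" where
  "similar xs ys \<longleftrightarrow> length xs = length ys \<and>
     (\<forall>i j. i < j \<and> j < length xs \<longrightarrow> (xs ! i < xs ! j \<longleftrightarrow> ys ! i < ys ! j))"

text \<open>
  A subsequence of \<open>\<pi>\<close> is given by the set \<open>A\<close> of positions it occupies; the sequence itself
  is \<^term>\<open>nths \<pi> A\<close>. So a collection of pairwise disjoint subsequences of length \<open>k \<ge> 1\<close>
  is a set of pairwise disjoint \<open>k\<close>-element sets of positions.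
\<close>

definition tight_twins :: "nat \<Rightarrow> nat \<Rightarrow> int list \<Rightarrow> nat set set \<Rightarrow> bool" where
  "tight_twins r k \<pi> T \<longleftrightarrow>
     finite T \<and> card T = r \<and>
     (\<forall>A\<in>T. A \<subseteq> {..<length \<pi>} \<and> card A = k) \<and>
     disjoint T \<and>
     (\<forall>A\<in>T. \<forall>B\<in>T. similar (nths \<pi> A) (nths \<pi> B)) \<and>
     (\<exists>s. \<Union>T = {s..<s + r * k})"

text \<open>
  The maximum is over a finite set, which is nonempty whenever \<open>1 \<le> k \<le> length \<pi>\<close>
  (any \<open>k\<close> consecutive entries form tight \<open>1\<close>-twins); other values of \<open>k\<close> are not meaningful.
\<close>

definition r_tt :: "nat \<Rightarrow> int list \<Rightarrow> nat" where
  "r_tt k \<pi> = Max {r. 1 \<le> r \<and> (\<exists>T. tight_twins r k \<pi> T)}"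

definition random_permutation :: "nat \<Rightarrow> int list pmf" where
  "random_permutation n = pmf_of_set (permutations_of_set {1..int n})"

end

theory Submission
  imports Defs "HOL-Real_Asymp.Real_Asymp"
begin

text \<open>
  The claim reduces to a statement about matchings. Call two positions \<^emph>\<open>rising\<close> if they carry
  values in the same order as the positions. Any partition of all \<open>n = 2h\<close> positions into rising
  pairs consists of pairwise similar increasing subsequences of length 2 covering everything, and
  no tight twins of length 2 can have more than \<open>h\<close> members. So it suffices that a random permutation
  has a perfect matching into rising pairs asymptotically almost surely.

  Split the plot of the permutation \<open>\<sigma>\<close> into four quadrants at \<open>h\<close>. Every point of the lower left
  quadrant \<open>L\<close> is below and to the left of every point of the upper right quadrant \<open>U\<close>, and
  \<open>L\<close> and \<open>U\<close> have equally many points, so they are a large reservoir of freely matchable points.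
  The other two quadrants \<open>TL\<close> (left, high values) and \<open>BR\<close> (right, low values) are first matched
  internally as far as possible. What remains unmatched there contains no rising pair, so it is a
  decreasing sequence, and decreasing sequences are short (of order \<open>\<surd>n\<close>). The leftover points of
  \<open>TL\<close> and \<open>BR\<close> are then matched into the reservoir. The delicate ones are the points near the two
  anti-diagonal corners, which have few partners:

  \<^item> a leftover point of \<open>TL\<close> at position at least \<open>p\<close> is matched to a point of \<open>L\<close> at a position
    less than \<open>p\<close>; of those there are about \<open>p / 2\<close>, far more than \<open>\<surd>n\<close>;
  \<^item> a leftover point of \<open>TL\<close> at a position less than \<open>p\<close> is matched to a point of \<open>U\<close> among the
    highest \<open>r\<close> values; only about \<open>\<surd>p\<close> such leftovers exist, since they are decreasing too, and
    about \<open>r / 2\<close> partners. This needs their values to be less than \<open>n - r\<close>, which holds because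
    the corner of \<open>p\<close> positions and \<open>r\<close> values is expected to contain only \<open>p r / n\<close> points.

  All of this works if \<open>p\<close> exceeds \<open>\<surd>n\<close>, \<open>r\<close> exceeds \<open>\<surd>p\<close> and \<open>p r\<close> is less than \<open>n\<close>, in order of
  magnitude; the exponents \<open>0.6\<close> and \<open>0.38\<close> leave room. The treatment of \<open>BR\<close> is the same after
  rotation by a half turn. Finally the rest of \<open>L\<close> and \<open>U\<close> is matched across; if one of the two is
  larger, it contains rising pairs, and removing some of them balances the sizes
  (\<open>matchable_join\<close>). This deterministic part is \<open>rising_perfect_matching\<close>.

  The random part needs three estimates: the union bound \<open>prob_some_hit\<close> for empty corners, the
  second moment bound \<open>prob_few_hits\<close> for the number of points in a rectangle, and the
  first moment bound \<open>prob_long_decreasing\<close> for long decreasing sequences. All of them follow from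
  the invariance of the uniform distribution under rearrangement of the positions
  (\<open>uniform_perm_comp\<close>).
\<close>

section \<open>Matchings along a relation\<close>

text \<open>
  A set is matchable if it splits into pairs related by \<open>R\<close>. The inductive form makes unions and
  exchange arguments easy; the set of pairs itself is only recovered in
  \<open>matchable_rising_pairs\<close>.
\<close>

inductive matchable :: "('a \<Rightarrow> 'a \<Rightarrow> bool) \<Rightarrow> 'a set \<Rightarrow> bool" for R where
  empty: "matchable R {}"
| pair: "matchable R X \<Longrightarrow> a \<notin> X \<Longrightarrow> b \<notin> X \<Longrightarrow> a \<noteq> b \<Longrightarrow> R a b
    \<Longrightarrow> matchable R (insert a (insert b X))"

definition indep :: "('a \<Rightarrow> 'a \<Rightarrow> bool) \<Rightarrow> 'a set \<Rightarrow> bool" where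
  "indep R S \<longleftrightarrow> (\<forall>a\<in>S. \<forall>b\<in>S. a \<noteq> b \<longrightarrow> \<not> R a b)"

lemma indep_subset: "indep R S \<Longrightarrow> T \<subseteq> S \<Longrightarrow> indep R T"
  unfolding indep_def by blast

lemma matchable_finite: "matchable R X \<Longrightarrow> finite X"
  by (induction rule: matchable.induct) auto

lemma matchable_even: "matchable R X \<Longrightarrow> even (card X)"
proof (induction rule: matchable.induct)
  case (pair X a b)
  then show ?case using matchable_finite[OF pair(1)] by simp
qed simp

lemma matchable_Un:
  assumes "matchable R X" "matchable R Y" "X \<inter> Y = {}"
  shows "matchable R (X \<union> Y)"
  using assms
proof (induction rule: matchable.induct)
  case (pair X a b)
  then have "matchable R (X \<union> Y)" by blast
  from matchable.pair[OF this, of a b] pair show ?case by (simp add: insert_commute)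
qed simp

lemma matchable_image:
  assumes "finite D" "inj_on f D" "D \<inter> f ` D = {}" "\<And>x. x \<in> D \<Longrightarrow> R x (f x)"
  shows "matchable R (D \<union> f ` D)"
  using assms
proof (induction rule: finite_induct)
  case empty
  then show ?case by (simp add: matchable.empty)
next
  case (insert x D)
  have "matchable R (D \<union> f ` D)"
    using insert by (intro insert.IH) auto
  moreover have "x \<notin> D \<union> f ` D" "f x \<notin> D \<union> f ` D" "x \<noteq> f x"
    using insert.hyps insert.prems by (auto simp: inj_on_def)
  ultimately have "matchable R (insert x (insert (f x) (D \<union> f ` D)))"
    using insert.prems by (intro matchable.pair) auto
  then show ?case by (simp add: insert_commute)
qed

text \<open>Pairs are removed until none is left; what remains is independent.\<close>

lemma maximal_matching:
  assumes "finite X"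
  shows "\<exists>M I. M \<union> I = X \<and> M \<inter> I = {} \<and> matchable R M \<and> indep R I"
  using assms
proof (induction X rule: finite_psubset_induct)
  case (psubset X)
  show ?case
  proof (cases "indep R X")
    case True
    then show ?thesis by (intro exI[of _ "{}"] exI[of _ X]) (auto simp: matchable.empty)
  next
    case False
    then obtain a b where ab: "a \<in> X" "b \<in> X" "a \<noteq> b" "R a b"
      unfolding indep_def by blast
    then have "X - {a, b} \<subset> X" by blast
    from psubset.IH[OF this] obtain M I where
      MI: "M \<union> I = X - {a, b}" "M \<inter> I = {}" "matchable R M" "indep R I" by blast
    have "a \<notin> M" "b \<notin> M" "a \<notin> I" "b \<notin> I" using MI(1) by blast+
    then have "matchable R (insert a (insert b M))"
      using MI ab by (intro matchable.pair) auto
    moreover have "insert a (insert b M) \<union> I = X" using MI(1) ab by blast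
    moreover have "insert a (insert b M) \<inter> I = {}" using MI(2) \<open>a \<notin> I\<close> \<open>b \<notin> I\<close> by blast
    ultimately show ?thesis using MI(4) by blast
  qed
qed

text \<open>
  The two sides need not have equal size: as long as \<open>X\<close> is larger than \<open>Y\<close>, it is too large to be
  independent, so a pair inside \<open>X\<close> can be split off. By parity this ends with equal sizes, where any
  bijection is a matching.
\<close>

lemma matchable_join:
  assumes "finite X" "finite Y" "X \<inter> Y = {}"
    and "\<And>x y. x \<in> X \<Longrightarrow> y \<in> Y \<Longrightarrow> R x y"
    and "\<And>S. S \<subseteq> X \<Longrightarrow> indep R S \<Longrightarrow> card S \<le> card Y"
    and "card Y \<le> card X" "even (card X + card Y)"
  shows "matchable R (X \<union> Y)"
  using assms(1,3-)
proof (induction X rule: finite_psubset_induct)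
  case (psubset X)
  show ?case
  proof (cases "card X = card Y")
    case True
    then obtain f where f: "bij_betw f X Y"
      using psubset.hyps assms(2) finite_same_card_bij by blast
    have fY: "f ` X = Y" and "inj_on f X" using f by (auto simp: bij_betw_def)
    have "matchable R (X \<union> f ` X)"
    proof (rule matchable_image)
      show "X \<inter> f ` X = {}" using fY psubset.prems(1) by simp
      fix x assume "x \<in> X"
      then show "R x (f x)" using psubset.prems(2) fY by blast
    qed (use \<open>inj_on f X\<close> psubset.hyps in auto)
    then show ?thesis using fY by simp
  next
    case False
    then have gt: "card Y < card X" using psubset.prems by simp
    have "\<not> indep R X" using psubset.prems(3)[of X] gt by auto
    then obtain a b where ab: "a \<in> X" "b \<in> X" "a \<noteq> b" "R a b"
      unfolding indep_def by blast
    have cX: "card (X - {a, b}) = card X - 2" using ab psubset.hyps by (simp add: card_Diff_subset)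
    have ge: "card Y + 2 \<le> card X" using gt psubset.prems(5) by presburger
    have "matchable R ((X - {a, b}) \<union> Y)"
    proof (rule psubset.IH)
      show "X - {a, b} \<subset> X" using ab by blast
      show "(X - {a, b}) \<inter> Y = {}" using psubset.prems(1) by blast
      show "card Y \<le> card (X - {a, b})" using cX ge by simp
      have "card X = card (X - {a, b}) + 2" using cX ge by simp
      then show "even (card (X - {a, b}) + card Y)" using psubset.prems(5) by simp
      show "R x y" if "x \<in> X - {a, b}" "y \<in> Y" for x y using psubset.prems(2) that by blast
      show "card S \<le> card Y" if "S \<subseteq> X - {a, b}" "indep R S" for S
        using psubset.prems(3) that by blast
    qed
    then have "matchable R (insert a (insert b ((X - {a, b}) \<union> Y)))"
      using ab psubset.prems(1) by (intro matchable.pair) auto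
    moreover have "insert a (insert b ((X - {a, b}) \<union> Y)) = X \<union> Y" using ab by blast
    ultimately show ?thesis by simp
  qed
qed

text \<open>
  Greedy choice: each candidate set is so large that the earlier choices and the forbidden set \<open>F\<close>
  cannot exhaust it.
\<close>

lemma distinct_representatives:
  assumes "finite D" "finite F" "\<And>x. x \<in> D \<Longrightarrow> finite (C x)"
    and "\<And>x. x \<in> D \<Longrightarrow> card D + card F \<le> card (C x)"
  shows "\<exists>f. inj_on f D \<and> (\<forall>x\<in>D. f x \<in> C x - F)"
  using assms(1,3,4)
proof (induction D rule: finite_induct)
  case empty
  then show ?case by simp
next
  case (insert x D)
  have "\<And>y. y \<in> D \<Longrightarrow> card D + card F \<le> card (C y)"
    using insert.prems(2) insert.hyps by fastforce
  with insert obtain f where f: "inj_on f D" "\<And>y. y \<in> D \<Longrightarrow> f y \<in> C y - F" by blast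
  have "card (f ` D \<union> F) \<le> card D + card F"
    by (meson add_le_mono1 card_Un_le card_image_le insert.hyps(1) le_trans)
  also have "\<dots> < card (C x)" using insert.prems(2)[of x] insert.hyps by simp
  finally have "\<not> C x \<subseteq> f ` D \<union> F"
    using card_mono[of "f ` D \<union> F" "C x"] insert.hyps(1) assms(2) by auto
  then obtain c where c: "c \<in> C x" "c \<notin> f ` D" "c \<notin> F" by blast
  have "inj_on (f(x := c)) (insert x D)"
    using f(1) c(2) insert.hyps(2) by (auto simp: inj_on_def)
  moreover have "\<forall>y\<in>insert x D. (f(x := c)) y \<in> C y - F"
    using f(2) c insert.hyps(2) by auto
  ultimately show ?case by blast
qed

section \<open>A sufficient condition for a perfect matching into rising pairs\<close>

definition rising :: "(nat \<Rightarrow> nat) \<Rightarrow> nat \<Rightarrow> nat \<Rightarrow> bool" where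
  "rising \<sigma> i j \<longleftrightarrow> i < j \<and> \<sigma> i < \<sigma> j \<or> j < i \<and> \<sigma> j < \<sigma> i"

text \<open>
  The hypotheses are the typical properties of a random permutation: two empty corners, short
  decreasing sequences (overall, in the first \<open>p\<close> and in the last \<open>p\<close> positions), and many points in
  the parts of the reservoir that serve the leftovers. The bound \<open>3 * d\<close> pays for at most \<open>2 * d\<close>
  leftovers and keeps \<open>d\<close> reservoir points on either side for the final balancing.
\<close>

lemma rising_perfect_matching:
  fixes h p r d d0 :: nat and \<sigma> :: "nat \<Rightarrow> nat"
  defines "n \<equiv> 2 * h"
  assumes perm: "\<sigma> permutes {..<n}" and "p \<le> h" "r \<le> h"
    and corner1: "\<And>i. i < p \<Longrightarrow> \<sigma> i < n - r"
    and corner2: "\<And>i. n - p \<le> i \<Longrightarrow> i < n \<Longrightarrow> r \<le> \<sigma> i"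
    and dec: "\<And>S. S \<subseteq> {..<n} \<Longrightarrow> indep (rising \<sigma>) S \<Longrightarrow> card S \<le> d"
    and dec1: "\<And>S. S \<subseteq> {..<p} \<Longrightarrow> indep (rising \<sigma>) S \<Longrightarrow> card S \<le> d0"
    and dec2: "\<And>S. S \<subseteq> {n - p..<n} \<Longrightarrow> indep (rising \<sigma>) S \<Longrightarrow> card S \<le> d0"
    and many1: "3 * d \<le> card {i\<in>{..<p}. \<sigma> i \<in> {..<h}}"
    and many2: "3 * d \<le> card {i\<in>{n - p..<n}. \<sigma> i \<in> {h..<n}}"
    and many3: "2 * d0 \<le> card {i\<in>{h..<n}. \<sigma> i \<in> {n - r..<n}}"
    and many4: "2 * d0 \<le> card {i\<in>{..<h}. \<sigma> i \<in> {..<r}}"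
  shows "matchable (rising \<sigma>) {..<n}"
proof -
  let ?R = "rising \<sigma>"
  define L where "L = {i\<in>{..<h}. \<sigma> i \<in> {..<h}}"
  define U where "U = {i\<in>{h..<n}. \<sigma> i \<in> {h..<n}}"
  define TL where "TL = {i\<in>{..<h}. \<sigma> i \<in> {h..<n}}"
  define BR where "BR = {i\<in>{h..<n}. \<sigma> i \<in> {..<h}}"
  have lt: "\<sigma> i < n" if "i < n" for i
    using permutes_in_image[OF perm, of i] that by simp
  have hn: "h \<le> n" and nh: "n - h = h" unfolding n_def by auto
  have fin: "finite L" "finite U" "finite TL" "finite BR"
    unfolding L_def U_def TL_def BR_def by auto
  have parts: "L \<union> U \<union> TL \<union> BR = {..<n}"
    unfolding L_def U_def TL_def BR_def using hn lt by fastforce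
  have disj: "L \<inter> U = {}" "L \<inter> TL = {}" "L \<inter> BR = {}" "U \<inter> TL = {}" "U \<inter> BR = {}" "TL \<inter> BR = {}"
    unfolding L_def U_def TL_def BR_def by auto
  \<comment> \<open>The left half has \<open>h\<close> positions and the upper half has \<open>h\<close> values.\<close>
  have LU: "card L = card U"
  proof -
    have "L \<union> TL = {..<h}" unfolding L_def TL_def using lt hn by fastforce
    then have 1: "card L + card TL = h"
      using card_Un_disjoint[OF fin(1,3) disj(2)] by simp
    have "\<sigma> ` (U \<union> TL) = {h..<n}"
    proof
      show "{h..<n} \<subseteq> \<sigma> ` (U \<union> TL)"
      proof
        fix v assume v: "v \<in> {h..<n}"
        then obtain i where "i < n" "\<sigma> i = v" using permutes_image[OF perm] by (metis atLeastLessThan_iff imageE lessThan_iff)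
        then show "v \<in> \<sigma> ` (U \<union> TL)" using v unfolding U_def TL_def by fastforce
      qed
    qed (auto simp: U_def TL_def)
    moreover have "inj_on \<sigma> (U \<union> TL)" using permutes_inj[OF perm] by (rule inj_on_subset) simp
    ultimately have "card (U \<union> TL) = n - h" by (metis card_atLeastLessThan card_image)
    then have "card U + card TL = h"
      using card_Un_disjoint[OF fin(2,3) disj(4)] nh by simp
    with 1 show ?thesis by simp
  qed
  obtain MT DT where T: "MT \<union> DT = TL" "MT \<inter> DT = {}" "matchable ?R MT" "indep ?R DT"
    using maximal_matching[OF fin(3)] by blast
  obtain MB DB where B: "MB \<union> DB = BR" "MB \<inter> DB = {}" "matchable ?R MB" "indep ?R DB"
    using maximal_matching[OF fin(4)] by blast
  define D where "D = DT \<union> DB"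
  have finD: "finite DT" "finite DB" "finite D"
    unfolding D_def using T(1) B(1) fin(3,4) by (metis finite_Un)+
  have "card DT \<le> d" by (rule dec[OF _ T(4)]) (use T(1) parts in blast)
  moreover have "card DB \<le> d" by (rule dec[OF _ B(4)]) (use B(1) parts in blast)
  ultimately have cD: "card D \<le> 2 * d" unfolding D_def using card_Un_le[of DT DB] by linarith
  define D0 where "D0 = (DT \<inter> {..<p}) \<union> (DB \<inter> {n - p..<n})"
  define D1 where "D1 = D - D0"
  have D0D: "D0 \<subseteq> D" unfolding D0_def D_def by blast
  have cD0: "card D0 \<le> 2 * d0"
  proof -
    have "card (DT \<inter> {..<p}) \<le> d0"
      by (rule dec1) (use indep_subset[OF T(4)] in auto)
    moreover have "card (DB \<inter> {n - p..<n}) \<le> d0"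
      by (rule dec2) (use indep_subset[OF B(4)] in auto)
    ultimately show ?thesis unfolding D0_def
      using card_Un_le[of "DT \<inter> {..<p}" "DB \<inter> {n - p..<n}"] by linarith
  qed
  \<comment> \<open>\<open>C0\<close> and \<open>C1\<close> are the candidate partners of leftovers near and far from a corner; \<open>i < h\<close>
    tells \<open>TL\<close> from \<open>BR\<close>. The scarcer candidates \<open>C0\<close> are used first, and the leftovers
    served by \<open>C1\<close> must avoid the partners already taken.\<close>
  define C0 where "C0 i = (if i < h then {i\<in>{h..<n}. \<sigma> i \<in> {n - r..<n}} else {i\<in>{..<h}. \<sigma> i \<in> {..<r}})" for i
  define C1 where "C1 i = (if i < h then {i\<in>{..<p}. \<sigma> i \<in> {..<h}} else {i\<in>{n - p..<n}. \<sigma> i \<in> {h..<n}})" for i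
  have "\<exists>f. inj_on f D0 \<and> (\<forall>x\<in>D0. f x \<in> C0 x - {})"
  proof (rule distinct_representatives)
    show "finite D0" using finD(3) D0D by (rule finite_subset[rotated])
    show "finite (C0 x)" for x by (simp add: C0_def)
    show "card D0 + card {} \<le> card (C0 x)" for x
      using many3 many4 cD0 by (simp add: C0_def)
  qed simp
  then obtain f0 where f0: "inj_on f0 D0" "\<And>x. x \<in> D0 \<Longrightarrow> f0 x \<in> C0 x" by auto
  have cD01: "card D1 + card D0 = card D"
    unfolding D1_def using D0D finD by (metis add.commute card_Diff_subset card_mono finite_subset le_add_diff_inverse)
  have "\<exists>f. inj_on f D1 \<and> (\<forall>x\<in>D1. f x \<in> C1 x - f0 ` D0)"
  proof (rule distinct_representatives)
    show "finite D1" using finD(3) by (simp add: D1_def)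
    show "finite (f0 ` D0)" using finite_subset[OF D0D finD(3)] by simp
    show "finite (C1 x)" for x by (simp add: C1_def)
    have "card D1 + card (f0 ` D0) \<le> 2 * d"
      using cD01 cD card_image[OF f0(1)] by simp
    then show "card D1 + card (f0 ` D0) \<le> card (C1 x)" for x
      using many1 many2 by (simp add: C1_def)
  qed
  then obtain f1 where f1: "inj_on f1 D1" "\<And>x. x \<in> D1 \<Longrightarrow> f1 x \<in> C1 x - f0 ` D0" by auto
  define f where "f x = (if x \<in> D0 then f0 x else f1 x)" for x
  have D01: "D = D0 \<union> D1" "D0 \<inter> D1 = {}" unfolding D1_def using D0D by auto
  have injf: "inj_on f D"
  proof -
    have ne: "f x \<noteq> f y" if "x \<in> D0" "y \<in> D1" for x y
      using that f1(2)[of y] D01(2) unfolding f_def by (metis Diff_iff disjoint_iff imageI)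
    then have "f ` (D0 - D1) \<inter> f ` (D1 - D0) = {}" by blast
    moreover have "inj_on f D0" using f0(1) unfolding f_def by (simp add: inj_on_def)
    moreover have "inj_on f D1"
      using f1(1) D01(2) unfolding f_def inj_on_def by auto
    ultimately show ?thesis unfolding D01(1) by (simp add: inj_on_Un)
  qed
  have DTB: "DT \<subseteq> TL" "DB \<subseteq> BR" using T(1) B(1) by blast+
  have fprop: "f x \<in> L \<union> U \<and> ?R x (f x)" if "x \<in> D" for x
  proof (cases "x \<in> D0")
    case True
    have fx: "f x \<in> C0 x" using f0(2) True unfolding f_def by simp
    from True consider "x \<in> TL" "x < p" | "x \<in> BR" "n - p \<le> x" "x < n"
      unfolding D0_def using DTB by auto
    then show ?thesis
    proof cases
      case 1
      then have "\<sigma> x < n - r" using corner1 by simp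
      with 1 fx show ?thesis using \<open>r \<le> h\<close> nh
        unfolding C0_def TL_def L_def U_def rising_def by auto
    next
      case 2
      then have "r \<le> \<sigma> x" using corner2 by simp
      with 2 fx show ?thesis using \<open>r \<le> h\<close> nh
        unfolding C0_def BR_def L_def U_def rising_def by auto
    qed
  next
    case False
    with that have x: "x \<in> D1" unfolding D1_def by simp
    then have fx: "f x \<in> C1 x" using f1(2) False unfolding f_def by simp
    have "x \<in> DT \<union> DB" using x unfolding D1_def D_def by blast
    moreover have "p \<le> x" if "x \<in> DT" using False that unfolding D0_def by simp
    moreover have "x < n - p" if "x \<in> DB"
    proof -
      have "x < n" using that DTB(2) unfolding BR_def by auto
      then show ?thesis using False that unfolding D0_def by auto
    qed
    ultimately consider "x \<in> TL" "p \<le> x" | "x \<in> BR" "x < n - p" using DTB by blast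
    then show ?thesis
    proof cases
      case 1
      with fx show ?thesis using \<open>p \<le> h\<close> nh
        unfolding C1_def TL_def L_def U_def rising_def by auto
    next
      case 2
      with fx show ?thesis using \<open>p \<le> h\<close> nh
        unfolding C1_def BR_def L_def U_def rising_def by auto
    qed
  qed
  have fD: "f ` D \<subseteq> L \<union> U" using fprop by auto
  have D_LU: "D \<inter> (L \<union> U) = {}" unfolding D_def using DTB disj(2-5) by blast
  have mD: "matchable ?R (D \<union> f ` D)"
    using finD(3) injf fprop fD D_LU by (intro matchable_image) auto
  \<comment> \<open>The reservoir that is left is matched across; its size is even because \<open>n\<close> is even
    and everything else is already matched.\<close>
  define L' where "L' = L - f ` D"
  define U' where "U' = U - f ` D"
  have finLU': "finite L'" "finite U'" using fin unfolding L'_def U'_def by auto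
  have MTB: "MT \<subseteq> TL" "MB \<subseteq> BR" using T(1) B(1) by blast+
  have LU': "(L' \<union> U') \<union> f ` D = L \<union> U" using fD unfolding L'_def U'_def by blast
  have TBs: "(MT \<union> MB) \<union> D = TL \<union> BR" unfolding D_def T(1)[symmetric] B(1)[symmetric]
    by (simp only: Un_ac)
  have "{..<n} = (TL \<union> BR) \<union> (L \<union> U)" unfolding parts[symmetric] by (simp only: Un_ac)
  then have split: "{..<n} = (MT \<union> MB) \<union> ((D \<union> f ` D) \<union> (L' \<union> U'))"
    unfolding LU'[symmetric] TBs[symmetric] by (simp only: Un_ac)
  have d1: "MT \<inter> MB = {}" using MTB disj(6) by blast
  have d2: "(D \<union> f ` D) \<inter> (L' \<union> U') = {}" using D_LU unfolding L'_def U'_def by blast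
  have d3: "(MT \<union> MB) \<inter> ((D \<union> f ` D) \<union> (L' \<union> U')) = {}"
  proof -
    have "(MT \<union> MB) \<inter> D = {}"
      unfolding D_def using MTB DTB T(2) B(2) disj(6) by blast
    moreover have "(MT \<union> MB) \<inter> (L \<union> U) = {}" using MTB disj(2-5) by blast
    ultimately show ?thesis unfolding LU'[symmetric] by blast
  qed
  have mM: "matchable ?R (MT \<union> MB)" by (rule matchable_Un[OF T(3) B(3) d1])
  have "card {..<n} = card (MT \<union> MB) + (card (D \<union> f ` D) + card (L' \<union> U'))"
    unfolding split
    using matchable_finite[OF mM] matchable_finite[OF mD] finLU'
    by (subst card_Un_disjoint[OF _ _ d3] card_Un_disjoint[OF _ _ d2]; simp add: card_Un_disjoint[OF _ _ d2])
  then have "even (card (MT \<union> MB) + (card (D \<union> f ` D) + card (L' \<union> U')))"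
    unfolding n_def by (metis card_lessThan dvd_triv_left)
  then have evLU: "even (card (L' \<union> U'))"
    using matchable_even[OF mM] matchable_even[OF mD] by (metis even_add)
  have disj': "L' \<inter> U' = {}" using disj(1) unfolding L'_def U'_def by blast
  have ev: "even (card L' + card U')"
    using evLU card_Un_disjoint[OF finLU' disj'] by simp
  have cfD: "card (f ` D) \<le> 2 * d" using card_image[OF injf] cD by simp
  have cL: "d \<le> card L'"
  proof -
    have "card {i\<in>{..<p}. \<sigma> i \<in> {..<h}} \<le> card L"
      unfolding L_def using \<open>p \<le> h\<close> by (intro card_mono) auto
    then have "3 * d \<le> card L" using many1 by linarith
    moreover have "card L - card (f ` D) \<le> card L'"
      unfolding L'_def using finD by (intro diff_card_le_card_Diff) auto
    ultimately show ?thesis using cfD by linarith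
  qed
  have cU: "d \<le> card U'"
  proof -
    have "card {i\<in>{..<p}. \<sigma> i \<in> {..<h}} \<le> card L"
      unfolding L_def using \<open>p \<le> h\<close> by (intro card_mono) auto
    then have "3 * d \<le> card U" using many1 LU by linarith
    moreover have "card U - card (f ` D) \<le> card U'"
      unfolding U'_def using finD by (intro diff_card_le_card_Diff) auto
    ultimately show ?thesis using cfD by linarith
  qed
  have LUR: "?R x y" "?R y x" if "x \<in> L'" "y \<in> U'" for x y
    using that unfolding L'_def U'_def L_def U_def rising_def by auto
  have sub: "L' \<subseteq> {..<n}" "U' \<subseteq> {..<n}" using parts unfolding L'_def U'_def by auto
  have mLU: "matchable ?R (L' \<union> U')"
  proof (cases "card U' \<le> card L'")
    case True
    show ?thesis
    proof (rule matchable_join[OF finLU' disj' LUR(1) _ True ev])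
      fix S assume "S \<subseteq> L'" "indep ?R S"
      then have "card S \<le> d" using sub by (intro dec) auto
      then show "card S \<le> card U'" using cU by simp
    qed
  next
    case False
    have "matchable ?R (U' \<union> L')"
    proof (rule matchable_join[OF finLU'(2,1)])
      fix S assume "S \<subseteq> U'" "indep ?R S"
      then have "card S \<le> d" using sub by (intro dec) auto
      then show "card S \<le> card L'" using cL by simp
    qed (use disj' LUR False ev in \<open>auto simp: add.commute\<close>)
    then show ?thesis by (simp add: Un_commute)
  qed
  show ?thesis unfolding split
    by (rule matchable_Un[OF mM matchable_Un[OF mD mLU d2] d3])
qed

section \<open>Perfect matchings and tight twins\<close>

text \<open>
  Positions and values of \<open>\<sigma>\<close> count from 0, whereas the permutations of the theorem have values
  in \<open>{1..n}\<close>.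
\<close>

definition entries :: "nat \<Rightarrow> (nat \<Rightarrow> nat) \<Rightarrow> int list" where
  "entries n \<sigma> = map (\<lambda>i. int (\<sigma> i) + 1) [0..<n]"

lemma nths_entries_pair:
  assumes "a < b" "b < n"
  shows "nths (entries n \<sigma>) {a, b} = [int (\<sigma> a) + 1, int (\<sigma> b) + 1]"
proof -
  have "nths [0..<n] {a, b} = [a, b]"
  proof (rule sorted_distinct_set_unique)
    show "set (nths [0..<n] {a, b}) = set [a, b]" using assms
      unfolding set_nths by (auto intro: exI[of _ a] exI[of _ b])
    show "sorted (nths [0..<n] {a, b})" by (intro sorted_nths) simp
  qed (use assms in auto)
  then show ?thesis unfolding entries_def by (simp add: nths_map)
qed

lemma matchable_rising_pairs:
  assumes "matchable (rising \<sigma>) X"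
  shows "\<exists>T. finite T \<and> 2 * card T = card X \<and> disjoint T \<and> \<Union>T = X \<and>
    (\<forall>A\<in>T. \<exists>a b. A = {a, b} \<and> a < b \<and> \<sigma> a < \<sigma> b)"
  using assms
proof (induction rule: matchable.induct)
  case empty
  then show ?case by (intro exI[of _ "{}"]) auto
next
  case (pair X a b)
  then obtain T where T: "finite T" "2 * card T = card X" "disjoint T" "\<Union>T = X"
    "\<forall>A\<in>T. \<exists>a b. A = {a, b} \<and> a < b \<and> \<sigma> a < \<sigma> b" by blast
  have new: "\<exists>a' b'. {a, b} = {a', b'} \<and> a' < b' \<and> \<sigma> a' < \<sigma> b'"
    using pair(5) unfolding rising_def by (metis insert_commute)
  have notin: "{a, b} \<notin> T" using T(4) pair(2) by blast
  have "disjoint (insert {a, b} T)"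
    using T(3,4) pair(2,3) by (auto simp: pairwise_insert disjnt_def)
  moreover have "2 * card (insert {a, b} T) = card (insert a (insert b X))"
    using T(1,2) notin pair(2-4) matchable_finite[OF pair(1)] by simp
  moreover have "\<Union>(insert {a, b} T) = insert a (insert b X)" using T(4) by auto
  ultimately show ?case using T(1,5) new
    by (intro exI[of _ "insert {a, b} T"]) auto
qed

text \<open>
  The upper bound is plain counting: \<open>r\<close> disjoint pairs occupy \<open>2 * r\<close> of the \<open>2 * h\<close> positions.
\<close>

lemma r_tt_entries_eq:
  assumes "matchable (rising \<sigma>) {..<2 * h}" "1 \<le> h"
  shows "r_tt 2 (entries (2 * h) \<sigma>) = h"
proof -
  let ?xs = "entries (2 * h) \<sigma>"
  have len: "length ?xs = 2 * h" by (simp add: entries_def)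
  obtain T where T: "finite T" "2 * card T = card {..<2 * h}" "disjoint T" "\<Union>T = {..<2 * h}"
    "\<forall>A\<in>T. \<exists>a b. A = {a, b} \<and> a < b \<and> \<sigma> a < \<sigma> b"
    using matchable_rising_pairs[OF assms(1)] by blast
  have shape: "\<exists>u v. nths ?xs A = [u, v] \<and> u < v" if A: "A \<in> T" for A
  proof -
    obtain a b where ab: "A = {a, b}" "a < b" "\<sigma> a < \<sigma> b" using T(5) A by blast
    have "b < 2 * h" using T(4) A ab(1) by blast
    then show ?thesis using nths_entries_pair[OF ab(2)] ab by auto
  qed
  have twins: "tight_twins h 2 ?xs T"
    unfolding tight_twins_def
  proof (intro conjI ballI)
    show "card T = h" using T(2) by simp
    show "A \<subseteq> {..<length ?xs}" if "A \<in> T" for A using T(4) that len by auto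
    show "card A = 2" if A: "A \<in> T" for A
    proof -
      obtain a b where "A = {a, b}" "a < b" using T(5) A by blast
      then show ?thesis by simp
    qed
    show "similar (nths ?xs A) (nths ?xs B)" if "A \<in> T" "B \<in> T" for A B
      using shape[OF that(1)] shape[OF that(2)]
      by (auto simp: similar_def less_Suc_eq numeral_2_eq_2)
    show "\<exists>s. \<Union>T = {s..<s + h * 2}" using T(4) by (intro exI[of _ 0]) auto
  qed (rule T(1) T(3))+
  have bound: "r \<le> h" if "tight_twins r 2 ?xs T'" for r T'
  proof -
    obtain s where s: "\<Union>T' = {s..<s + r * 2}" using \<open>tight_twins r 2 ?xs T'\<close> unfolding tight_twins_def by blast
    have "\<Union>T' \<subseteq> {..<2 * h}" using \<open>tight_twins r 2 ?xs T'\<close> len unfolding tight_twins_def by auto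
    then have "card {s..<s + r * 2} \<le> card {..<2 * h}" unfolding s by (intro card_mono) auto
    then show ?thesis by simp
  qed
  show ?thesis unfolding r_tt_def
  proof (rule Max_eqI)
    show "finite {r. 1 \<le> r \<and> (\<exists>T. tight_twins r 2 ?xs T)}"
    proof (rule finite_subset)
      show "{r. 1 \<le> r \<and> (\<exists>T. tight_twins r 2 ?xs T)} \<subseteq> {..h}" using bound by blast
    qed simp
    show "h \<in> {r. 1 \<le> r \<and> (\<exists>T. tight_twins r 2 ?xs T)}" using twins assms(2) by blast
    show "r \<le> h" if "r \<in> {r. 1 \<le> r \<and> (\<exists>T. tight_twins r 2 ?xs T)}" for r
      using that bound by blast
  qed
qed

section \<open>Uniformly random permutations\<close>

definition uniform_perm :: "nat \<Rightarrow> (nat \<Rightarrow> nat) pmf" where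
  "uniform_perm n = pmf_of_set {\<sigma>. \<sigma> permutes {..<n}}"

lemma finite_perms: "finite {\<sigma>. \<sigma> permutes {..<n::nat}}"
  by (simp add: finite_permutations)

lemma perms_nonempty: "{\<sigma>. \<sigma> permutes {..<n::nat}} \<noteq> {}"
  using permutes_id by blast

lemma set_uniform_perm: "set_pmf (uniform_perm n) = {\<sigma>. \<sigma> permutes {..<n}}"
  unfolding uniform_perm_def by (rule set_pmf_of_set[OF perms_nonempty finite_perms])

lemma prob_uniform_perm_mono:
  assumes "\<And>\<sigma>. \<sigma> permutes {..<n} \<Longrightarrow> P \<sigma> \<Longrightarrow> Q \<sigma>"
  shows "measure_pmf.prob (uniform_perm n) {\<sigma>. P \<sigma>} \<le> measure_pmf.prob (uniform_perm n) {\<sigma>. Q \<sigma>}"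
  using assms set_uniform_perm[of n]
  by (intro measure_pmf.finite_measure_mono_AE) (auto simp: AE_measure_pmf_iff)

text \<open>
  Rearranging the positions is a bijection of the sample space. This symmetry is the only property
  of the uniform distribution that the estimates below use.
\<close>

lemma uniform_perm_comp:
  assumes "\<tau> permutes {..<n}"
  shows "measure_pmf.prob (uniform_perm n) {\<sigma>. P (\<sigma> \<circ> \<tau>)} = measure_pmf.prob (uniform_perm n) {\<sigma>. P \<sigma>}"
proof -
  let ?S = "{\<sigma>. \<sigma> permutes {..<n}}"
  have "bij_betw (\<lambda>\<sigma>. \<sigma> \<circ> \<tau>) ?S ?S"
  proof (rule bij_betw_byWitness[where f' = "\<lambda>\<sigma>. \<sigma> \<circ> inv \<tau>"])
    show "\<forall>\<sigma>\<in>?S. (\<sigma> \<circ> \<tau>) \<circ> inv \<tau> = \<sigma>" "\<forall>\<sigma>\<in>?S. (\<sigma> \<circ> inv \<tau>) \<circ> \<tau> = \<sigma>"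
      using permutes_inv_o[OF assms] by (auto simp: o_assoc[symmetric])
    show "(\<lambda>\<sigma>. \<sigma> \<circ> \<tau>) ` ?S \<subseteq> ?S" "(\<lambda>\<sigma>. \<sigma> \<circ> inv \<tau>) ` ?S \<subseteq> ?S"
      using assms permutes_inv[OF assms] by (auto intro: permutes_compose)
  qed
  then have "map_pmf (\<lambda>\<sigma>. \<sigma> \<circ> \<tau>) (uniform_perm n) = uniform_perm n"
    unfolding uniform_perm_def by (rule map_pmf_of_set_bij_betw[OF _ perms_nonempty finite_perms])
  then have "measure_pmf.prob (uniform_perm n) {\<sigma>. P \<sigma>}
      = measure_pmf.prob (map_pmf (\<lambda>\<sigma>. \<sigma> \<circ> \<tau>) (uniform_perm n)) {\<sigma>. P \<sigma>}" by simp
  also have "\<dots> = measure_pmf.prob (uniform_perm n) {\<sigma>. P (\<sigma> \<circ> \<tau>)}"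
    by (simp add: measure_map_pmf vimage_def)
  finally show ?thesis by simp
qed

lemma prob_eq_expectation:
  "measure_pmf.prob p {x. P x} = measure_pmf.expectation p (\<lambda>x. of_bool (P x))"
proof -
  have "measure_pmf.expectation p (\<lambda>x. of_bool (P x)) = measure_pmf.expectation p (indicator {x. P x})"
    by (intro Bochner_Integration.integral_cong) (auto simp: indicator_def)
  also have "\<dots> = measure_pmf.prob p {x. P x}" by simp
  finally show ?thesis ..
qed

lemma integrable_uniform_perm: "integrable (measure_pmf (uniform_perm n)) (f :: _ \<Rightarrow> real)"
  by (rule integrable_measure_pmf_finite) (simp add: set_uniform_perm finite_perms)

lemma expectation_cong_perm:
  assumes "\<And>\<sigma>. \<sigma> permutes {..<n} \<Longrightarrow> f \<sigma> = (g \<sigma> :: real)"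
  shows "measure_pmf.expectation (uniform_perm n) f = measure_pmf.expectation (uniform_perm n) g"
  using assms set_uniform_perm[of n] by (intro integral_cong_AE) (auto simp: AE_measure_pmf_iff)

lemma count_hits:
  fixes n :: nat
  assumes "\<sigma> permutes {..<n}" "B \<subseteq> {..<n}"
  shows "(\<Sum>i<n. of_bool (\<sigma> i \<in> B)) = real (card B)"
proof -
  have "bij_betw \<sigma> {..<n} {..<n}" using permutes_imp_bij[OF assms(1)] .
  then have "(\<Sum>i<n. of_bool (\<sigma> i \<in> B)) = (\<Sum>v<n. of_bool (v \<in> B) :: real)"
    by (rule sum.reindex_bij_betw)
  also have "\<dots> = card ({..<n} \<inter> B)" by (subst sum_of_bool_eq) simp_all
  also have "{..<n} \<inter> B = B" using assms(2) by blast
  finally show ?thesis .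
qed

text \<open>
  By symmetry all positions are equally likely to take a value in \<open>B\<close>, and exactly \<open>card B\<close> of them
  do so.
\<close>

lemma prob_hit:
  assumes "i < n" "B \<subseteq> {..<n}"
  shows "measure_pmf.prob (uniform_perm n) {\<sigma>. \<sigma> i \<in> B} = card B / n"
proof -
  let ?P = "\<lambda>j. measure_pmf.prob (uniform_perm n) {\<sigma>. \<sigma> j \<in> B}"
  have eq: "?P j = ?P i" if "j < n" for j
    using uniform_perm_comp[of "Transposition.transpose i j" n "\<lambda>\<sigma>. \<sigma> i \<in> B"] assms(1) that
    by (simp add: permutes_swap_id)
  have "real n * ?P i = (\<Sum>j<n. ?P j)" by (simp add: eq)
  also have "\<dots> = measure_pmf.expectation (uniform_perm n) (\<lambda>\<sigma>. \<Sum>j<n. of_bool (\<sigma> j \<in> B))"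
    by (simp add: prob_eq_expectation Bochner_Integration.integral_sum integrable_uniform_perm
        del: sum_of_bool_eq)
  also have "\<dots> = measure_pmf.expectation (uniform_perm n) (\<lambda>\<sigma>. real (card B))"
    using assms(2) by (intro expectation_cong_perm count_hits)
  finally show ?thesis using assms(1) by (simp add: field_simps)
qed

text \<open>
  Negative correlation of two hits: if \<open>i\<close> takes a value in \<open>B\<close>, then exactly \<open>card B - 1\<close> of the other
  \<open>n - 1\<close> positions do so, all with equal probability.
\<close>

lemma prob_two_hits:
  assumes "i < n" "j < n" "i \<noteq> j" "B \<subseteq> {..<n}"
  shows "measure_pmf.prob (uniform_perm n) {\<sigma>. \<sigma> i \<in> B \<and> \<sigma> j \<in> B} \<le> (card B / n)\<^sup>2"
proof -
  let ?P = "\<lambda>j. measure_pmf.prob (uniform_perm n) {\<sigma>. \<sigma> i \<in> B \<and> \<sigma> j \<in> B}"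
  have eq: "?P k = ?P j" if "k < n" "k \<noteq> i" for k
    using uniform_perm_comp[of "Transposition.transpose j k" n "\<lambda>\<sigma>. \<sigma> i \<in> B \<and> \<sigma> j \<in> B"] assms that
    by (simp add: permutes_swap_id)
  have "real (n - 1) * ?P j = (\<Sum>k\<in>{..<n} - {i}. ?P k)" using assms(1) by (simp add: eq)
  also have "\<dots> = measure_pmf.expectation (uniform_perm n)
      (\<lambda>\<sigma>. \<Sum>k\<in>{..<n} - {i}. of_bool (\<sigma> i \<in> B \<and> \<sigma> k \<in> B))"
    by (simp add: prob_eq_expectation Bochner_Integration.integral_sum integrable_uniform_perm
        del: sum_of_bool_eq)
  also have "\<dots> = measure_pmf.expectation (uniform_perm n)
      (\<lambda>\<sigma>. of_bool (\<sigma> i \<in> B) * (real (card B) - 1))"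
  proof (rule expectation_cong_perm)
    fix \<sigma> assume s: "\<sigma> permutes {..<n}"
    have "(\<Sum>k\<in>{..<n} - {i}. of_bool (\<sigma> i \<in> B \<and> \<sigma> k \<in> B))
      = of_bool (\<sigma> i \<in> B) * (\<Sum>k\<in>{..<n} - {i}. of_bool (\<sigma> k \<in> B) :: real)"
      by (simp add: of_bool_conj sum_distrib_left)
    also have "(\<Sum>k\<in>{..<n} - {i}. of_bool (\<sigma> k \<in> B)) = real (card B) - of_bool (\<sigma> i \<in> B)"
      using count_hits[OF s assms(4)] assms(1)
      by (simp add: sum_diff1 del: sum_of_bool_eq)
    finally show "(\<Sum>k\<in>{..<n} - {i}. of_bool (\<sigma> i \<in> B \<and> \<sigma> k \<in> B))
      = of_bool (\<sigma> i \<in> B) * (real (card B) - 1)" by auto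
  qed
  also have "\<dots> = card B / n * (real (card B) - 1)"
    using prob_hit[OF assms(1,4)] by (simp add: prob_eq_expectation)
  finally have main: "real (n - 1) * ?P j = card B / n * (real (card B) - 1)" .
  have n: "2 \<le> n" using assms(1-3) by linarith
  have "card B \<le> n" using card_mono[OF _ assms(4)] by simp
  then have "(real (card B) - 1) * n \<le> card B * real (n - 1)"
    using n by (simp add: of_nat_diff algebra_simps)
  then have "(real (card B) - 1) / real (n - 1) \<le> card B / n"
    using n by (simp add: field_simps)
  then have "card B / n * ((real (card B) - 1) / real (n - 1)) \<le> card B / n * (card B / n)"
    by (rule mult_left_mono) simp
  moreover have "?P j = card B / n * ((real (card B) - 1) / real (n - 1))"
    using main n by (simp add: field_simps)
  ultimately show ?thesis by (simp add: power2_eq_square)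
qed

text \<open>
  Chebyshev's inequality: by negative correlation the variance of the number of hits is at most its
  mean \<open>\<mu>\<close>.
\<close>

lemma prob_few_hits:
  assumes "A \<subseteq> {..<n}" "B \<subseteq> {..<n}" and \<mu>: "\<mu> = real (card A) * card B / n" "0 < \<mu>"
  shows "measure_pmf.prob (uniform_perm n) {\<sigma>. real (card {i\<in>A. \<sigma> i \<in> B}) \<le> \<mu> / 2} \<le> 4 / \<mu>"
proof -
  let ?M = "uniform_perm n" and ?E = "measure_pmf.expectation (uniform_perm n)"
  define X where "X \<sigma> = (\<Sum>i\<in>A. of_bool (\<sigma> i \<in> B) :: real)" for \<sigma> :: "nat \<Rightarrow> nat"
  note int = integrable_uniform_perm
  have finA: "finite A" using assms(1) finite_subset by blast
  have X: "X \<sigma> = card {i\<in>A. \<sigma> i \<in> B}" for \<sigma>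
    unfolding X_def using finA by (simp add: of_bool_def sum.If_cases Int_def)
  have hit: "?E (\<lambda>\<sigma>. of_bool (\<sigma> i \<in> B)) = card B / n" if "i \<in> A" for i
    using prob_hit[of i n B] assms that by (auto simp: prob_eq_expectation)
  have EX: "?E X = \<mu>"
    unfolding X_def using hit \<mu>(1) by (simp add: Bochner_Integration.integral_sum int)
  have pair: "?E (\<lambda>\<sigma>. of_bool (\<sigma> i \<in> B) * of_bool (\<sigma> j \<in> B) :: real)
      \<le> (card B / n)\<^sup>2 + (if i = j then card B / n else 0)" if "i \<in> A" "j \<in> A" for i j
  proof (cases "i = j")
    case True
    have "?E (\<lambda>\<sigma>. of_bool (\<sigma> i \<in> B) * of_bool (\<sigma> j \<in> B) :: real) = ?E (\<lambda>\<sigma>. of_bool (\<sigma> i \<in> B))"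
      using True by (intro Bochner_Integration.integral_cong) (simp_all add: of_bool_def)
    then show ?thesis using hit[OF that(1)] True by simp
  next
    case False
    then show ?thesis using prob_two_hits[of i n j B] that assms(1,2)
      by (auto simp: prob_eq_expectation of_bool_conj)
  qed
  have "?E (\<lambda>\<sigma>. (X \<sigma>)\<^sup>2) = (\<Sum>i\<in>A. \<Sum>j\<in>A. ?E (\<lambda>\<sigma>. of_bool (\<sigma> i \<in> B) * of_bool (\<sigma> j \<in> B)))"
    unfolding X_def power2_eq_square sum_product
    by (simp add: Bochner_Integration.integral_sum int)
  also have "\<dots> \<le> (\<Sum>i\<in>A. \<Sum>j\<in>A. (card B / n)\<^sup>2 + (if i = j then card B / n else 0))"
    by (intro sum_mono pair)
  also have "\<dots> = \<mu>\<^sup>2 + \<mu>"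
    using finA \<mu>(1) by (simp add: sum.distrib sum.delta power2_eq_square distrib_left)
  finally have EX2: "?E (\<lambda>\<sigma>. (X \<sigma>)\<^sup>2) \<le> \<mu>\<^sup>2 + \<mu>" .
  have "?E (\<lambda>\<sigma>. (X \<sigma> - ?E X)\<^sup>2) = ?E (\<lambda>\<sigma>. (X \<sigma>)\<^sup>2) - (?E X)\<^sup>2"
    by (intro measure_pmf.variance_eq int)
  then have var: "?E (\<lambda>\<sigma>. (X \<sigma> - ?E X)\<^sup>2) \<le> \<mu>" using EX2 EX by simp
  have "{\<sigma>. real (card {i\<in>A. \<sigma> i \<in> B}) \<le> \<mu> / 2} \<subseteq> {\<sigma>. \<mu> / 2 \<le> \<bar>X \<sigma> - ?E X\<bar>}"
    unfolding EX X by auto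
  then have "measure_pmf.prob ?M {\<sigma>. real (card {i\<in>A. \<sigma> i \<in> B}) \<le> \<mu> / 2}
      \<le> measure_pmf.prob ?M {\<sigma>. \<mu> / 2 \<le> \<bar>X \<sigma> - ?E X\<bar>}"
    by (intro measure_pmf.finite_measure_mono) auto
  also have "\<dots> \<le> ?E (\<lambda>\<sigma>. (X \<sigma> - ?E X)\<^sup>2) / (\<mu> / 2)\<^sup>2"
    using measure_pmf.Chebyshev_inequality[of X ?M "\<mu> / 2"] int \<mu>(2) by simp
  also have "\<dots> \<le> \<mu> / (\<mu> / 2)\<^sup>2" using var by (intro divide_right_mono) auto
  also have "\<dots> = 4 / \<mu>" using \<mu>(2) by (simp add: power2_eq_square)
  finally show ?thesis .
qed

lemma prob_some_hit:
  assumes "A \<subseteq> {..<n}" "B \<subseteq> {..<n}"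
  shows "measure_pmf.prob (uniform_perm n) {\<sigma>. \<exists>i\<in>A. \<sigma> i \<in> B} \<le> real (card A) * card B / n"
proof -
  have "{\<sigma>. \<exists>i\<in>A. \<sigma> i \<in> B} = (\<Union>i\<in>A. {\<sigma>. \<sigma> i \<in> B})" by auto
  moreover have "finite A" using assms(1) finite_subset by blast
  ultimately have "measure_pmf.prob (uniform_perm n) {\<sigma>. \<exists>i\<in>A. \<sigma> i \<in> B}
      \<le> (\<Sum>i\<in>A. measure_pmf.prob (uniform_perm n) {\<sigma>. \<sigma> i \<in> B})"
    using measure_pmf.finite_measure_subadditive_finite[of A "\<lambda>i. {\<sigma>. \<sigma> i \<in> B}"] by simp
  also have "\<dots> = (\<Sum>i\<in>A. card B / n)" using assms by (intro sum.cong prob_hit) auto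
  finally show ?thesis by simp
qed

section \<open>Long decreasing sequences are unlikely\<close>

definition decreasing_on :: "nat set \<Rightarrow> (nat \<Rightarrow> nat) \<Rightarrow> bool" where
  "decreasing_on S \<sigma> \<longleftrightarrow> (\<forall>i\<in>S. \<forall>j\<in>S. i < j \<longrightarrow> \<sigma> j < \<sigma> i)"

text \<open>
  Values that decrease along \<open>S\<close> are determined by the set of values that occur: sorted, they
  form one particular list. This makes the events in the next proof disjoint.
\<close>

lemma decreasing_rearrangement_unique:
  assumes "finite S" "\<tau> permutes S" "\<tau>' permutes S" "inj \<sigma>"
    and "decreasing_on S (\<sigma> \<circ> \<tau>)" "decreasing_on S (\<sigma> \<circ> \<tau>')"
  shows "\<tau> = \<tau>'"
proof -
  let ?s = "sorted_list_of_set S"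
  have img: "(\<sigma> \<circ> t) ` S = \<sigma> ` S" if "t permutes S" for t
    using permutes_image[OF that] by (metis image_comp)
  have srt: "sorted (rev (map (\<sigma> \<circ> t) ?s))" if "decreasing_on S (\<sigma> \<circ> t)" for t
  proof -
    have ss: "sorted_wrt (<) ?s" by simp
    have "sorted_wrt (\<lambda>x y. (\<sigma> \<circ> t) y \<le> (\<sigma> \<circ> t) x) ?s"
      by (rule sorted_wrt_mono_rel[OF _ ss])
        (use that assms(1) in \<open>auto simp: decreasing_on_def intro: less_imp_le\<close>)
    then show ?thesis by (simp add: sorted_wrt_rev sorted_wrt_map)
  qed
  have dis: "distinct (rev (map (\<sigma> \<circ> t) ?s))" if "t permutes S" for t
    using inj_compose[OF assms(4) permutes_inj[OF that]]
    by (simp add: distinct_map inj_on_subset[of _ UNIV])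
  have "rev (map (\<sigma> \<circ> \<tau>) ?s) = rev (map (\<sigma> \<circ> \<tau>') ?s)"
    using assms(1) img[OF assms(2)] img[OF assms(3)]
    by (intro sorted_distinct_set_unique srt dis assms) simp
  then have "\<forall>i\<in>S. \<sigma> (\<tau> i) = \<sigma> (\<tau>' i)" using assms(1) by simp
  then have "\<forall>i\<in>S. \<tau> i = \<tau>' i" using assms(4) by (simp add: inj_eq)
  then show ?thesis
    using permutes_not_in[OF assms(2)] permutes_not_in[OF assms(3)] by (metis ext)
qed

text \<open>
  The \<open>k!\<close> rearrangements of the positions in \<open>S\<close> give equally likely, pairwise disjoint events.
\<close>

lemma prob_decreasing_on:
  assumes "S \<subseteq> {..<n}"
  shows "measure_pmf.prob (uniform_perm n) {\<sigma>. decreasing_on S \<sigma>} \<le> 1 / fact (card S)"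
proof -
  let ?M = "uniform_perm n"
  define E where "E \<tau> = {\<sigma>. \<sigma> permutes {..<n} \<and> decreasing_on S (\<sigma> \<circ> \<tau>)}" for \<tau>
  let ?T = "{\<tau>. \<tau> permutes S}"
  have fin: "finite S" using assms finite_subset by blast
  have E: "measure_pmf.prob ?M (E \<tau>) = measure_pmf.prob ?M {\<sigma>. decreasing_on S \<sigma>}" if "\<tau> \<in> ?T" for \<tau>
  proof -
    have "measure_pmf.prob ?M (E \<tau>) = measure_pmf.prob ?M {\<sigma>. decreasing_on S (\<sigma> \<circ> \<tau>)}"
      unfolding E_def by (rule measure_prob_cong_0)
        (auto simp: set_uniform_perm pmf_eq_0_set_pmf)
    also have "\<dots> = measure_pmf.prob ?M {\<sigma>. decreasing_on S \<sigma>}"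
      using permutes_subset[of \<tau> S "{..<n}"] that assms by (intro uniform_perm_comp) auto
    finally show ?thesis .
  qed
  have disj: "disjoint_family_on E ?T"
    unfolding disjoint_family_on_def E_def
    using decreasing_rearrangement_unique[OF fin] permutes_inj by blast
  have "fact (card S) * measure_pmf.prob ?M {\<sigma>. decreasing_on S \<sigma>} = (\<Sum>\<tau>\<in>?T. measure_pmf.prob ?M (E \<tau>))"
    by (simp add: E card_permutations[OF refl fin])
  also have "\<dots> = measure_pmf.prob ?M (\<Union>(E ` ?T))"
    using measure_pmf.finite_measure_finite_Union[of ?T E ?M] disj fin
    by (simp add: finite_permutations)
  also have "\<dots> \<le> 1" by simp
  finally show ?thesis by (simp add: field_simps)
qed

lemma power_div_fact_le_exp:
  fixes x :: real
  assumes "0 \<le> x"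
  shows "x ^ k / fact k \<le> exp x"
proof -
  have "(\<Sum>m<Suc k. x ^ m /\<^sub>R fact m) \<le> exp x"
    using exp_converges[of x] assms
    by (subst sums_unique[OF exp_converges]) (intro sum_le_suminf, auto simp: sums_iff)
  moreover have "0 \<le> (\<Sum>m<k. x ^ m /\<^sub>R fact m)"
    using assms by (intro sum_nonneg) simp
  ultimately have "x ^ k /\<^sub>R fact k \<le> exp x" by simp
  then show ?thesis by (simp add: divide_inverse mult.commute)
qed

text \<open>
  With \<open>q\<close> positions available there are \<open>q choose k\<close> candidates, so the probability is at most
  \<open>q ^ k / (k!)\<^sup>2\<close>, which \<open>k! \<ge> (k / e) ^ k\<close> turns into \<open>(e\<^sup>2 q / k\<^sup>2) ^ k\<close>. Since the base is at most 1,
  the first power is an upper bound as well, and it suffices for the limit.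
\<close>

lemma prob_long_decreasing:
  assumes "Q \<subseteq> {..<n}" "1 \<le> k" "exp 2 * real (card Q) \<le> (real k)\<^sup>2"
  shows "measure_pmf.prob (uniform_perm n) {\<sigma>. \<exists>S\<subseteq>Q. card S = k \<and> decreasing_on S \<sigma>}
    \<le> exp 2 * card Q / (real k)\<^sup>2"
proof -
  let ?C = "{S. S \<subseteq> Q \<and> card S = k}"
  have fin: "finite Q" using assms(1) finite_subset by blast
  have "{\<sigma>. \<exists>S\<subseteq>Q. card S = k \<and> decreasing_on S \<sigma>} = (\<Union>S\<in>?C. {\<sigma>. decreasing_on S \<sigma>})" by auto
  then have "measure_pmf.prob (uniform_perm n) {\<sigma>. \<exists>S\<subseteq>Q. card S = k \<and> decreasing_on S \<sigma>}
      \<le> (\<Sum>S\<in>?C. measure_pmf.prob (uniform_perm n) {\<sigma>. decreasing_on S \<sigma>})"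
    using measure_pmf.finite_measure_subadditive_finite[of ?C "\<lambda>S. {\<sigma>. decreasing_on S \<sigma>}"] fin by simp
  also have "\<dots> \<le> (\<Sum>S\<in>?C. 1 / fact k)"
    using assms(1) by (intro sum_mono) (use prob_decreasing_on[of _ n] in force)
  also have "\<dots> = real (card Q choose k) / fact k" by (simp add: n_subsets[OF fin])
  also have "\<dots> \<le> (real (card Q) ^ k / fact k) / fact k"
  proof -
    have "real ((card Q choose k) * fact k) \<le> real (card Q ^ k)"
      using binomial_fact_pow of_nat_le_iff by blast
    then show ?thesis by (intro divide_right_mono) (simp_all add: field_simps)
  qed
  also have "\<dots> = real (card Q) ^ k / (fact k)\<^sup>2" by (simp add: power2_eq_square)
  also have "\<dots> \<le> (exp 2 * card Q / (real k)\<^sup>2) ^ k"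
  proof -
    have "real k ^ k / fact k \<le> exp (real k)"
      by (rule power_div_fact_le_exp) simp
    then have "(real k ^ k)\<^sup>2 \<le> (exp (real k) * fact k)\<^sup>2"
      by (intro power_mono) (simp_all add: field_simps)
    then have "((real k)\<^sup>2) ^ k \<le> exp 2 ^ k * (fact k)\<^sup>2"
      by (simp add: power_mult_distrib power_even_eq[symmetric] exp_of_nat_mult[symmetric]
        exp_double[symmetric] power_mult[symmetric] mult.commute)
    then show ?thesis using assms(2)
      by (simp add: field_simps power_mult_distrib power_divide mult_left_mono)
  qed
  also have "\<dots> \<le> (exp 2 * card Q / (real k)\<^sup>2) ^ 1"
    using assms(2,3) by (intro power_decreasing) (auto simp: field_simps)
  finally show ?thesis by simp
qed

section \<open>A perfect matching exists asymptotically almost surely\<close>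

lemma random_permutation_eq:
  "random_permutation n = map_pmf (entries n) (uniform_perm n)"
proof -
  let ?S = "{\<sigma>. \<sigma> permutes {..<n}}"
  have inj: "inj_on (entries n) ?S"
  proof (rule inj_onI)
    fix \<sigma> \<tau> assume st: "\<sigma> \<in> ?S" "\<tau> \<in> ?S" "entries n \<sigma> = entries n \<tau>"
    from st(3) have "\<forall>i<n. \<sigma> i = \<tau> i" by (simp add: entries_def)
    moreover have "\<sigma> i = \<tau> i" if "\<not> i < n" for i
      using permutes_not_in[of \<sigma> "{..<n}" i] permutes_not_in[of \<tau> "{..<n}" i] st(1,2) that by simp
    ultimately show "\<sigma> = \<tau>" by blast
  qed
  have "entries n \<sigma> \<in> permutations_of_set {1..int n}" if "\<sigma> \<in> ?S" for \<sigma>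
  proof -
    have s: "\<sigma> ` {..<n} = {..<n}" "inj \<sigma>" using that permutes_image permutes_inj by auto
    have "set (entries n \<sigma>) = (\<lambda>v. int v + 1) ` \<sigma> ` {..<n}"
      by (auto simp: entries_def)
    also have "\<dots> = {1..int n}"
    proof
      show "{1..int n} \<subseteq> (\<lambda>v. int v + 1) ` \<sigma> ` {..<n}"
      proof
        fix v assume "v \<in> {1..int n}"
        then have "v = int (nat (v - 1)) + 1" "nat (v - 1) \<in> {..<n}" by auto
        then show "v \<in> (\<lambda>v. int v + 1) ` \<sigma> ` {..<n}" unfolding s(1) by blast
      qed
    qed (auto simp: s(1))
    finally have "set (entries n \<sigma>) = {1..int n}" .
    moreover have "distinct (entries n \<sigma>)"
      unfolding entries_def distinct_map by (simp add: inj_on_def inj_eq[OF s(2)])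
    ultimately show ?thesis by (simp add: permutations_of_set_def)
  qed
  then have "entries n ` ?S \<subseteq> permutations_of_set {1..int n}" by blast
  moreover have "card (entries n ` ?S) = card (permutations_of_set {1..int n})"
    using card_image[OF inj] by (simp add: card_permutations[of _ n])
  ultimately have "entries n ` ?S = permutations_of_set {1..int n}"
    by (intro card_subset_eq) auto
  then show ?thesis
    unfolding random_permutation_def uniform_perm_def
    using map_pmf_of_set_inj[OF inj perms_nonempty finite_perms] by simp
qed

lemma indep_rising_imp_decreasing:
  assumes "inj \<sigma>" "indep (rising \<sigma>) S"
  shows "decreasing_on S \<sigma>"
  unfolding decreasing_on_def
proof (intro ballI impI)
  fix i j assume "i \<in> S" "j \<in> S" "i < j"
  then have "\<not> \<sigma> i < \<sigma> j" "\<sigma> i \<noteq> \<sigma> j"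
    using assms inj_eq[of \<sigma> i j] by (auto simp: indep_def rising_def)
  then show "\<sigma> j < \<sigma> i" by simp
qed

lemma decreasing_card_bound:
  assumes "inj \<sigma>" "finite Q" "\<not> (\<exists>S\<subseteq>Q. card S = d + 1 \<and> decreasing_on S \<sigma>)"
    and "S \<subseteq> Q" "indep (rising \<sigma>) S"
  shows "card S \<le> d"
proof (rule ccontr)
  assume "\<not> card S \<le> d"
  then obtain T where "T \<subseteq> S" "card T = d + 1"
    using obtain_subset_with_card_n[of "d + 1" S] by auto
  moreover have "decreasing_on T \<sigma>"
    using indep_rising_imp_decreasing[OF assms(1) indep_subset[OF assms(5) \<open>T \<subseteq> S\<close>]] .
  ultimately show False using assms(3,4) by blast
qed

text \<open>
  The union bound over the nine ways in which the hypotheses of \<open>rising_perfect_matching\<close> can fail.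
  The factors 12 and 8 reflect that a count with mean \<open>p / 2\<close> is only guaranteed to reach half its
  mean, and that \<open>3 * d\<close>, respectively \<open>2 * d0\<close>, reservoir points are required.
\<close>

lemma failure_probability:
  fixes h p r d d0 :: nat
  defines "n \<equiv> 2 * h"
  assumes "1 \<le> p" "p \<le> h" "1 \<le> r" "r \<le> h" "12 * d \<le> p" "8 * d0 \<le> r"
    and big: "exp 2 * real n \<le> (real (d + 1))\<^sup>2" "exp 2 * real p \<le> (real (d0 + 1))\<^sup>2"
  shows "measure_pmf.prob (random_permutation n) {\<pi>. r_tt 2 \<pi> \<noteq> n div 2}
    \<le> 2 * (real p * r / n) + exp 2 * n / (real (d + 1))\<^sup>2 + 2 * (exp 2 * p / (real (d0 + 1))\<^sup>2)
      + 16 / p + 16 / r"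
proof -
  let ?pr = "measure_pmf.prob (uniform_perm n)"
  define b1 where "b1 = {\<sigma>. \<exists>i\<in>{..<p}. \<sigma> i \<in> {n - r..<n}}"
  define b2 where "b2 = {\<sigma>. \<exists>i\<in>{n - p..<n}. \<sigma> i \<in> {..<r}}"
  define dec where "dec Q k = {\<sigma>. \<exists>S\<subseteq>Q. card S = k + 1 \<and> decreasing_on S \<sigma>}" for Q k
  \<comment> \<open>All four rectangles have mean \<open>s / 2\<close> for \<open>s = p\<close> or \<open>s = r\<close>: one side is half of \<open>n\<close>.\<close>
  define few where "few A B s = {\<sigma>. real (card {i\<in>A. \<sigma> i \<in> B}) \<le> real s / 2 / 2}"
    for A B :: "nat set" and s :: nat
  have n0: "0 < n" "p \<le> n" "r \<le> n" "h \<le> n" "n - h = h" using assms(2-5) by (auto simp: n_def)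
  have c1: "?pr b1 \<le> real p * r / n" "?pr b2 \<le> real p * r / n"
    unfolding b1_def b2_def using prob_some_hit[of "{..<p}" n "{n - r..<n}"]
      prob_some_hit[of "{n - p..<n}" n "{..<r}"] n0(2,3) by (simp_all add: subset_iff)
  have c2: "?pr (dec {..<n} d) \<le> exp 2 * n / (real (d + 1))\<^sup>2"
    unfolding dec_def using prob_long_decreasing[of "{..<n}" n "d + 1"] big by simp
  have c3: "?pr (dec {..<p} d0) \<le> exp 2 * p / (real (d0 + 1))\<^sup>2"
    unfolding dec_def using prob_long_decreasing[of "{..<p}" n "d0 + 1"] big n0 by simp
  have c4: "?pr (dec {n - p..<n} d0) \<le> exp 2 * p / (real (d0 + 1))\<^sup>2"
    unfolding dec_def using prob_long_decreasing[of "{n - p..<n}" n "d0 + 1"] big n0(2)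
    by (simp add: subset_iff)
  have hits: "?pr (few A B s) \<le> 8 / s"
    if "A \<subseteq> {..<n}" "B \<subseteq> {..<n}" "card A * card B = s * h" "1 \<le> s" for A B s
  proof -
    have "real (card A) * card B = real s * h" by (simp only: of_nat_mult[symmetric] that(3))
    then have "real s / 2 = real (card A) * card B / n" using n0(1) by (simp add: n_def)
    from prob_few_hits[OF that(1,2) this] have "?pr (few A B s) \<le> 4 / (real s / 2)"
      unfolding few_def using that(4) by simp
    then show ?thesis by simp
  qed
  have c5: "?pr (few {..<p} {..<h} p) \<le> 8 / p" "?pr (few {n - p..<n} {h..<n} p) \<le> 8 / p"
  proof -
    have "card {n - p..<n} = p" "card {h..<n} = h" using n0(2,5) by simp_all
    then show "?pr (few {n - p..<n} {h..<n} p) \<le> 8 / p"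
      using assms(2) by (intro hits) (auto simp only: subset_iff atLeastLessThan_iff lessThan_iff)
    show "?pr (few {..<p} {..<h} p) \<le> 8 / p"
      using assms(2) n0(2,4) by (intro hits) (auto simp only: card_lessThan lessThan_subset_iff)
  qed
  have c6: "?pr (few {h..<n} {n - r..<n} r) \<le> 8 / r" "?pr (few {..<h} {..<r} r) \<le> 8 / r"
  proof -
    have "card {n - r..<n} = r" "card {h..<n} = h" using n0(3,5) by simp_all
    then show "?pr (few {h..<n} {n - r..<n} r) \<le> 8 / r"
      using assms(4)
      by (intro hits) (auto simp only: subset_iff atLeastLessThan_iff lessThan_iff mult.commute)
    show "?pr (few {..<h} {..<r} r) \<le> 8 / r"
      using assms(4) n0(3,4)
      by (intro hits) (auto simp only: card_lessThan lessThan_subset_iff mult.commute)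
  qed
  define bad where "bad = b1 \<union> (b2 \<union> (dec {..<n} d \<union> (dec {..<p} d0 \<union> (dec {n - p..<n} d0 \<union>
    (few {..<p} {..<h} p \<union> (few {n - p..<n} {h..<n} p \<union>
    (few {h..<n} {n - r..<n} r \<union> few {..<h} {..<r} r)))))))"
  have Un: "?pr (X \<union> Y) \<le> x + y" if "?pr X \<le> x" "?pr Y \<le> y" for X Y x y
    using measure_Un_le[of X "measure_pmf (uniform_perm n)" Y] that by simp
  have "?pr bad \<le> real p * r / n + (real p * r / n + (exp 2 * n / (real (d + 1))\<^sup>2 +
    (exp 2 * p / (real (d0 + 1))\<^sup>2 + (exp 2 * p / (real (d0 + 1))\<^sup>2 +
    (8 / p + (8 / p + (8 / r + 8 / r)))))))"
    unfolding bad_def by (intro Un c1 c2 c3 c4 c5 c6)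
  also have "\<dots> = 2 * (real p * r / n) + exp 2 * n / (real (d + 1))\<^sup>2 + 2 * (exp 2 * p / (real (d0 + 1))\<^sup>2)
      + 16 / p + 16 / r" by (simp add: add_divide_distrib[symmetric])
  finally have bound: "?pr bad \<le> \<dots>" .
  have good: "r_tt 2 (entries n \<sigma>) = n div 2" if s: "\<sigma> permutes {..<n}" and nb: "\<sigma> \<notin> bad" for \<sigma>
  proof -
    have nb': "\<sigma> \<notin> b1" "\<sigma> \<notin> b2" "\<sigma> \<notin> dec {..<n} d" "\<sigma> \<notin> dec {..<p} d0" "\<sigma> \<notin> dec {n - p..<n} d0"
      "\<sigma> \<notin> few {..<p} {..<h} p" "\<sigma> \<notin> few {n - p..<n} {h..<n} p"
      "\<sigma> \<notin> few {h..<n} {n - r..<n} r" "\<sigma> \<notin> few {..<h} {..<r} r"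
      using nb unfolding bad_def by auto
    have inj: "inj \<sigma>" using permutes_inj[OF s] .
    have lt: "\<sigma> i < n" if "i < n" for i using permutes_in_image[OF s, of i] that by simp
    have many: "t \<le> card {i\<in>A. \<sigma> i \<in> B}" if "\<sigma> \<notin> few A B q" "4 * t \<le> q" for A B q t
    proof -
      have "real q / 4 < real (card {i\<in>A. \<sigma> i \<in> B})" using that(1) by (simp add: few_def)
      moreover have "4 * real t \<le> real q" using that(2) by linarith
      ultimately show ?thesis by linarith
    qed
    have "matchable (rising \<sigma>) {..<n}"
    proof (rule rising_perfect_matching[of \<sigma> h p r d d0, folded n_def, OF s])
      show "\<sigma> i < n - r" if "i < p" for i
        using nb'(1) that lt[of i] n0 unfolding b1_def by (auto simp: not_le)
      show "r \<le> \<sigma> i" if "n - p \<le> i" "i < n" for i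
        using nb'(2) that unfolding b2_def by (auto simp: not_less)
      show "card S \<le> d" if "S \<subseteq> {..<n}" "indep (rising \<sigma>) S" for S
        using decreasing_card_bound[OF inj _ _ that] nb'(3) unfolding dec_def by simp
      show "card S \<le> d0" if "S \<subseteq> {..<p}" "indep (rising \<sigma>) S" for S
        using decreasing_card_bound[OF inj _ _ that] nb'(4) unfolding dec_def by simp
      show "card S \<le> d0" if "S \<subseteq> {n - p..<n}" "indep (rising \<sigma>) S" for S
        using decreasing_card_bound[OF inj _ _ that] nb'(5) unfolding dec_def by simp
      show "3 * d \<le> card {i\<in>{..<p}. \<sigma> i \<in> {..<h}}"
        by (rule many[OF nb'(6)]) (use assms(6) in simp)
      show "3 * d \<le> card {i\<in>{n - p..<n}. \<sigma> i \<in> {h..<n}}"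
        by (rule many[OF nb'(7)]) (use assms(6) in simp)
      show "2 * d0 \<le> card {i\<in>{h..<n}. \<sigma> i \<in> {n - r..<n}}"
        by (rule many[OF nb'(8)]) (use assms(7) in simp)
      show "2 * d0 \<le> card {i\<in>{..<h}. \<sigma> i \<in> {..<r}}"
        by (rule many[OF nb'(9)]) (use assms(7) in simp)
    qed (use assms(3,5) in auto)
    then show ?thesis using r_tt_entries_eq[of \<sigma> h] assms(2,3) by (simp add: n_def)
  qed
  have "measure_pmf.prob (random_permutation n) {\<pi>. r_tt 2 \<pi> \<noteq> n div 2}
      = ?pr {\<sigma>. r_tt 2 (entries n \<sigma>) \<noteq> n div 2}"
    by (simp add: random_permutation_eq measure_map_pmf vimage_def)
  also have "\<dots> \<le> ?pr {\<sigma>. \<sigma> \<in> bad}"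
    using good by (intro prob_uniform_perm_mono) blast
  also have "\<dots> = ?pr bad" by simp
  also note bound
  finally show ?thesis .
qed

theorem theorem6p1:
  "((\<lambda>n::nat. measure_pmf.prob (random_permutation n) {\<pi>. r_tt 2 \<pi> = n div 2}) \<longlongrightarrow> 1)
     (inf sequentially (principal {n. even n}))"
proof -
  let ?F = "inf sequentially (principal {n::nat. even n})"
  let ?pr = "\<lambda>n. measure_pmf.prob (random_permutation n) {\<pi>. r_tt 2 \<pi> = n div 2}"
  \<comment> \<open>The failure bound for \<open>p = n powr 0.6\<close>, \<open>r = n powr 0.38\<close>, \<open>d = n powr 0.55\<close> and
    \<open>d0 = n powr 0.35\<close>, where \<open>- 1\<close> allows for rounding down.\<close>
  define \<epsilon> :: "real \<Rightarrow> real" where "\<epsilon> x =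
    2 * (x powr (3/5) * x powr (19/50) / x) + exp 2 * x / (x powr (11/20))\<^sup>2
    + 2 * (exp 2 * x powr (3/5) / (x powr (7/20))\<^sup>2)
    + 16 / (x powr (3/5) - 1) + 16 / (x powr (19/50) - 1)" for x
  have lim: "((\<lambda>n::nat. \<epsilon> (real n)) \<longlongrightarrow> 0) sequentially"
    unfolding \<epsilon>_def by real_asymp
  have "eventually (\<lambda>n::nat. 2 \<le> real n powr (3/5)) sequentially" by real_asymp
  moreover have "eventually (\<lambda>n::nat. 2 \<le> real n powr (19/50)) sequentially" by real_asymp
  moreover have "eventually (\<lambda>n::nat. real n powr (3/5) \<le> real n / 2) sequentially" by real_asymp
  moreover have "eventually (\<lambda>n::nat. real n powr (19/50) \<le> real n / 2) sequentially" by real_asymp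
  moreover have "eventually (\<lambda>n::nat. 12 * real n powr (11/20) \<le> real n powr (3/5) - 1) sequentially"
    by real_asymp
  moreover have "eventually (\<lambda>n::nat. 8 * real n powr (7/20) \<le> real n powr (19/50) - 1) sequentially"
    by real_asymp
  moreover have "eventually (\<lambda>n::nat. exp 2 * real n \<le> (real n powr (11/20))\<^sup>2) sequentially"
    by real_asymp
  moreover have "eventually (\<lambda>n::nat. exp 2 * real n powr (3/5) \<le> (real n powr (7/20))\<^sup>2) sequentially"
    by real_asymp
  ultimately have "eventually (\<lambda>n::nat. even n \<longrightarrow> 1 - \<epsilon> (real n) \<le> ?pr n) sequentially"
  proof eventually_elim
    case (elim n)
    show ?case
    proof
      assume "even n"
      then obtain h where h: "n = 2 * h" by blast
      define p where "p = nat \<lfloor>real n powr (3/5)\<rfloor>"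
      define r where "r = nat \<lfloor>real n powr (19/50)\<rfloor>"
      define d where "d = nat \<lfloor>real n powr (11/20)\<rfloor>"
      define d0 where "d0 = nat \<lfloor>real n powr (7/20)\<rfloor>"
      have floor: "real (nat \<lfloor>x\<rfloor>) \<le> x" "x - 1 < real (nat \<lfloor>x\<rfloor>)" if "0 \<le> x" for x :: real
        using that by linarith+
      have p: "real p \<le> real n powr (3/5)" "real n powr (3/5) - 1 < p"
        and r: "real r \<le> real n powr (19/50)" "real n powr (19/50) - 1 < r"
        and d: "real d \<le> real n powr (11/20)" "real n powr (11/20) - 1 < d"
        and d0: "real d0 \<le> real n powr (7/20)" "real n powr (7/20) - 1 < d0"
        unfolding p_def r_def d_def d0_def by (intro floor; simp)+
      have dsq: "(real n powr (11/20))\<^sup>2 \<le> (real (d + 1))\<^sup>2"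
        using d by (intro power_mono) auto
      have d0sq: "(real n powr (7/20))\<^sup>2 \<le> (real (d0 + 1))\<^sup>2"
        using d0 by (intro power_mono) auto
      have pos: "1 \<le> p" "1 \<le> r" using p(2) r(2) elim(1,2) by linarith+
      have n0: "0 < n" using elim(1) by (cases "n = 0") auto
      have le: "p \<le> h" "r \<le> h" using p(1) r(1) elim(3,4) h by linarith+
      have gap: "12 * d \<le> p" "8 * d0 \<le> r" using d(1) d0(1) p(2) r(2) elim(5,6) by linarith+
      have big: "exp 2 * real n \<le> (real (d + 1))\<^sup>2" using elim(7) dsq by linarith
      have "exp 2 * real p \<le> exp 2 * real n powr (3/5)" using p(1) by simp
      then have big0: "exp 2 * real p \<le> (real (d0 + 1))\<^sup>2" using elim(8) d0sq by linarith
      have "measure_pmf.prob (random_permutation n) {\<pi>. r_tt 2 \<pi> \<noteq> n div 2}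
        \<le> 2 * (real p * r / n) + exp 2 * n / (real (d + 1))\<^sup>2 + 2 * (exp 2 * p / (real (d0 + 1))\<^sup>2)
          + 16 / p + 16 / r"
        using failure_probability[of p h r d d0, folded h] pos le gap big big0 by simp
      also have "\<dots> \<le> \<epsilon> (real n)"
        unfolding \<epsilon>_def
      proof (intro add_mono mult_left_mono)
        show "real p * r / n \<le> real n powr (3/5) * real n powr (19/50) / real n"
          using p(1) r(1) by (intro divide_right_mono mult_mono) auto
        show "exp 2 * n / (real (d + 1))\<^sup>2 \<le> exp 2 * n / (real n powr (11/20))\<^sup>2"
          using dsq n0 by (intro divide_left_mono) auto
        show "exp 2 * p / (real (d0 + 1))\<^sup>2 \<le> exp 2 * real n powr (3/5) / (real n powr (7/20))\<^sup>2"
          using d0sq n0 p(1) by (intro frac_le) auto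
        show "16 / real p \<le> 16 / (real n powr (3/5) - 1)"
          using p(2) elim(1) by (intro divide_left_mono) auto
        show "16 / real r \<le> 16 / (real n powr (19/50) - 1)"
          using r(2) elim(2) by (intro divide_left_mono) auto
      qed auto
      finally have "measure_pmf.prob (random_permutation n) {\<pi>. r_tt 2 \<pi> \<noteq> n div 2} \<le> \<epsilon> (real n)" .
      moreover have "measure_pmf.prob (random_permutation n) {\<pi>. r_tt 2 \<pi> \<noteq> n div 2} = 1 - ?pr n"
        using measure_pmf.prob_compl[of "{\<pi>. r_tt 2 \<pi> = n div 2}" "random_permutation n"]
        by (simp add: Compl_eq_Diff_UNIV[symmetric] Collect_neg_eq)
      ultimately show "1 - \<epsilon> (real n) \<le> ?pr n" by linarith
    qed
  qed
  then have low: "eventually (\<lambda>n. 1 - \<epsilon> (real n) \<le> ?pr n) ?F"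
    by (simp add: eventually_inf_principal)
  have "((\<lambda>n::nat. 1 - \<epsilon> (real n)) \<longlongrightarrow> 1 - 0) ?F"
    using lim by (intro tendsto_diff tendsto_const) (rule tendsto_mono[OF inf_le1])
  then have "((\<lambda>n::nat. 1 - \<epsilon> (real n)) \<longlongrightarrow> 1) ?F" by simp
  from tendsto_sandwich[OF low _ this tendsto_const] show ?thesis by simp
qed

end
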